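(* Let $n\geqslant1$, $t\geqslant1$, $k\ge1$, let $a_0,a_t$ be elements of a commutative ring with unity, and let $d=\gcd(n,t)$. Then \[ \operatorname{per}\bigl((a_0I_n+a_tP_n^t)\otimes J_k\bigr)=\Bigl[(k!)^{n/d}\sum_{l=0}^k\binom kl^{n/d}\bigl(a_0^{k-l}a_t^l\bigr)^{n/d}\Bigr]^d. \]
   Context: $P_n=(c_{i,j})_{1\le i,j\le n}$ with $c_{i,j}=1$ if $j-i\equiv1\pmod n$ and $0$ otherwise; $P_n^t$ is its $t$-th power. $J_k$ is the $k\times k$ all-ones matrix, $\otimes$ the Kronecker product, $\operatorname{per}$ the permanent. *)

theory Defs
  imports
    "Jordan_Normal_Form.Matrix"
    "HOL-Combinatorics.Permutations"
    "HOL-Number_Theory.Cong"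
begin

text \<open>As for \<^verbatim>\<open>det\<close> in the matrix library, non-square matrices get the dummy value 0.\<close>

definition permanent :: "'a :: comm_semiring_1 mat \<Rightarrow> 'a" where
  "permanent A = (if dim_row A = dim_col A
     then (\<Sum>p \<in> {p. p permutes {0..<dim_row A}}. \<Prod>i = 0..<dim_row A. A $$ (i, p i))
     else 0)"

definition kronecker_product :: "'a :: times mat \<Rightarrow> 'a mat \<Rightarrow> 'a mat" (infixl \<open>\<otimes>\<^sub>K\<close> 70) where
  "A \<otimes>\<^sub>K B = mat (dim_row A * dim_row B) (dim_col A * dim_col B)
     (\<lambda>(i, j). A $$ (i div dim_row B, j div dim_col B) * B $$ (i mod dim_row B, j mod dim_col B))"

text \<open>Indices run over \<open>0, \<dots>, n - 1\<close> instead of \<open>1, \<dots>, n\<close>; the condition depends only on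
  \<open>j - i\<close>, so the matrix is the same. The difference is taken in the integers because
  subtraction on the naturals truncates. For \<open>n = 1\<close> the matrix is \<open>(1)\<close>.\<close>

definition cyclic_shift_mat :: "nat \<Rightarrow> 'a :: {zero,one} mat" where
  "cyclic_shift_mat n = mat n n (\<lambda>(i, j). if [int j - int i = 1] (mod int n) then 1 else 0)"

definition all_ones_mat :: "nat \<Rightarrow> 'a :: one mat" where
  "all_ones_mat k = mat k k (\<lambda>_. 1)"

end

theory Submission
  imports Defs
begin

text \<open>Row \<open>i\<close> has entry \<open>a\<^sub>0\<close> in the columns of block \<open>i div k\<close> and \<open>a\<^sub>t\<close> in those of the block shifted
  by \<open>t\<close>. Expanding the products over rows, a set \<open>X\<close> of rows that take \<open>a\<^sub>t\<close> contributes
  \<open>a\<^sub>t ^ card X * a\<^sub>0 ^ (n * k - card X)\<close> times the number of permutations that send every row to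
  its prescribed block. This number is nonzero iff every block is prescribed for exactly \<open>k\<close> rows,
  in which case it is \<open>(k!) ^ n\<close>. If \<open>s c\<close> is the number of elements of \<open>X\<close> in block \<open>c\<close>, the
  condition reads \<open>s ((c + t) mod n) = s c\<close>, that is, \<open>s\<close> depends only on the residue modulo
  \<open>d = gcd n t\<close>. Summing over the \<open>d\<close> free values of \<open>s\<close> gives the \<open>d\<close>-th power.\<close>

section \<open>Counting permutations and subsets with prescribed labels\<close>

text \<open>Such a permutation restricts to a permutation of every fibre of \<open>g\<close>, and
  permutations chosen independently on the fibres glue together. \<open>?to\<close> glues and
  \<open>?from\<close> splits. Labels of \<open>C\<close> with an empty fibre contribute
  \<open>fact 0 = 1\<close>.\<close>

lemma card_permutes_fixing_label:
  assumes "finite A" "finite C" "g ` A \<subseteq> C"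
  shows "card {p. p permutes A \<and> (\<forall>i\<in>A. g (p i) = g i)} = (\<Prod>c\<in>C. fact (card {i\<in>A. g i = c}))"
proof -
  let ?F = "\<lambda>c. {i\<in>A. g i = c}"
  let ?P = "\<Pi>\<^sub>E c\<in>C. {q. q permutes ?F c}"
  let ?Q = "{p. p permutes A \<and> (\<forall>i\<in>A. g (p i) = g i)}"
  let ?to = "\<lambda>q i. if i \<in> A then q (g i) i else i"
  let ?from = "\<lambda>p. restrict (\<lambda>c i. if i \<in> ?F c then p i else i) C"
  have label: "q (g i) i \<in> A \<and> g (q (g i) i) = g i" if "q \<in> ?P" "i \<in> A" for q i
  proof -
    have "q (g i) permutes ?F (g i)" using that assms(3) by (auto simp: PiE_iff)
    from permutes_in_image[OF this, of i] show ?thesis using that by auto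
  qed
  have "bij_betw ?to ?P ?Q"
  proof (rule bij_betw_byWitness[where f' = ?from])
    show "\<forall>q\<in>?P. ?from (?to q) = q"
    proof
      fix q assume q: "q \<in> ?P"
      show "?from (?to q) = q"
      proof
        fix c
        show "?from (?to q) c = q c"
        proof (cases "c \<in> C")
          case True
          then have "q c permutes ?F c" using q by (auto simp: PiE_iff)
          then have "q c i = i" if "i \<notin> ?F c" for i using that by (rule permutes_not_in)
          with True show ?thesis by (auto simp: fun_eq_iff)
        next
          case False
          then show ?thesis using q by (auto simp: PiE_iff extensional_def)
        qed
      qed
    qed
    show "\<forall>p\<in>?Q. ?to (?from p) = p"
      using assms(3) by (auto simp: fun_eq_iff permutes_not_in)
    show "?to ` ?P \<subseteq> ?Q"
    proof (clarify, intro conjI ballI)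
      fix q assume q: "q \<in> ?P"
      show "?to q permutes A"
      proof (rule bij_imp_permutes)
        have "inj_on (?to q) A"
        proof (rule inj_onI)
          fix i j assume ij: "i \<in> A" "j \<in> A" "?to q i = ?to q j"
          then have "g i = g j" using label[OF q, of i] label[OF q, of j] by simp
          moreover have "q (g i) permutes ?F (g i)" using q ij assms(3) by (auto simp: PiE_iff)
          ultimately show "i = j" using ij by (auto dest!: permutes_inj simp: inj_eq)
        qed
        moreover have "?to q ` A \<subseteq> A" using label[OF q] by auto
        ultimately show "bij_betw (?to q) A A"
          using endo_inj_surj[OF assms(1)] unfolding bij_betw_def by blast
      qed simp
      show "g (?to q i) = g i" if "i \<in> A" for i using that label[OF q] by simp
    qed
    show "?from ` ?Q \<subseteq> ?P"
    proof (clarify)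
      fix p assume p: "p permutes A" and g: "\<forall>i\<in>A. g (p i) = g i"
      have "(\<lambda>i. if i \<in> ?F c then p i else i) permutes ?F c" for c
      proof (rule bij_imp_permutes)
        have "p ` ?F c \<subseteq> ?F c" using g permutes_in_image[OF p] by auto
        moreover have "inj_on p (?F c)" using permutes_inj[OF p] by (rule inj_on_subset) simp
        ultimately have "bij_betw p (?F c) (?F c)"
          using assms(1) by (simp add: bij_betw_def endo_inj_surj)
        then show "bij_betw (\<lambda>i. if i \<in> ?F c then p i else i) (?F c) (?F c)"
          by (subst bij_betw_cong[where g = p]) auto
      qed auto
      then show "?from p \<in> ?P" by (auto simp: PiE_iff)
    qed
  qed
  then have "card ?Q = card ?P" by (rule bij_betw_same_card[symmetric])
  also have "\<dots> = (\<Prod>c\<in>C. card {q. q permutes ?F c})" using assms(2) by (rule card_PiE)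
  also have "\<dots> = (\<Prod>c\<in>C. fact (card (?F c)))"
    using assms(1) by (intro prod.cong card_permutations) auto
  finally show ?thesis .
qed

text \<open>If the fibre sizes agree, one matching permutation \<open>p\<close> exists, and
  composition with \<open>p\<close> carries the permutations that preserve \<open>g\<close>
  bijectively to the matching ones. Conversely, any matching permutation maps each fibre of
  \<open>g\<close> onto the fibre of \<open>h\<close> with the same label, so unequal sizes leave
  none.\<close>

lemma card_permutes_matching_labels:
  assumes "finite A" "finite C" "g ` A \<subseteq> C" "h ` A \<subseteq> C"
  shows "card {p. p permutes A \<and> (\<forall>i\<in>A. h (p i) = g i)} =
    (if \<forall>c\<in>C. card {i\<in>A. g i = c} = card {i\<in>A. h i = c}
     then \<Prod>c\<in>C. fact (card {i\<in>A. h i = c}) else 0)"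
proof (cases "\<forall>c\<in>C. card {i\<in>A. g i = c} = card {i\<in>A. h i = c}")
  case True
  \<comment> \<open>Equal fibre sizes say that \<open>g\<close> and \<open>h\<close> have the same
    multiset of values on \<open>A\<close>; labels outside \<open>C\<close> occur for
    neither.\<close>
  have "image_mset g (mset_set A) = image_mset h (mset_set A)"
  proof (rule multiset_eqI)
    fix c
    have "{i\<in>A. g i = c} = {} \<and> {i\<in>A. h i = c} = {}" if "c \<notin> C" using that assms by auto
    then have "card {i\<in>A. g i = c} = card {i\<in>A. h i = c}" using True by (metis (lifting))
    then show "count (image_mset g (mset_set A)) c = count (image_mset h (mset_set A)) c"
      using assms(1) by (simp add: count_image_mset_eq_card_vimage)
  qed
  then obtain p where p: "p permutes A" and gh: "\<forall>x\<in>A. g x = h (p x)"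
    using image_mset_eq_implies_permutes[OF assms(1)] by metis
  have "bij_betw ((\<circ>) p) {q. q permutes A \<and> (\<forall>i\<in>A. g (q i) = g i)}
      {q. q permutes A \<and> (\<forall>i\<in>A. h (q i) = g i)}"
  proof (rule bij_betw_byWitness[where f' = "(\<circ>) (inv_into UNIV p)"])
    show "\<forall>q\<in>{q. q permutes A \<and> (\<forall>i\<in>A. g (q i) = g i)}. inv_into UNIV p \<circ> (p \<circ> q) = q"
      using permutes_inv_o(2)[OF p] by (simp add: o_assoc)
    show "\<forall>q\<in>{q. q permutes A \<and> (\<forall>i\<in>A. h (q i) = g i)}. p \<circ> (inv_into UNIV p \<circ> q) = q"
      using permutes_inv_o(1)[OF p] by (simp add: o_assoc)
    show "(\<circ>) p ` {q. q permutes A \<and> (\<forall>i\<in>A. g (q i) = g i)}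
        \<subseteq> {q. q permutes A \<and> (\<forall>i\<in>A. h (q i) = g i)}"
    proof (clarify, intro conjI ballI)
      fix q assume q: "q permutes A" "\<forall>i\<in>A. g (q i) = g i"
      show "p \<circ> q permutes A" by (rule permutes_compose[OF q(1) p])
      show "h ((p \<circ> q) i) = g i" if "i \<in> A" for i
        using gh q(2) permutes_in_image[OF q(1), of i] that by auto
    qed
    show "(\<circ>) (inv_into UNIV p) ` {q. q permutes A \<and> (\<forall>i\<in>A. h (q i) = g i)}
        \<subseteq> {q. q permutes A \<and> (\<forall>i\<in>A. g (q i) = g i)}"
    proof (clarify, intro conjI ballI)
      fix q assume q: "q permutes A" "\<forall>i\<in>A. h (q i) = g i"
      show "inv_into UNIV p \<circ> q permutes A" by (rule permutes_compose[OF q(1) permutes_inv[OF p]])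
      show "g ((inv_into UNIV p \<circ> q) i) = g i" if "i \<in> A" for i
      proof -
        have "inv_into UNIV p (q i) \<in> A"
          using permutes_in_image[OF q(1)] permutes_in_image[OF permutes_inv[OF p]] that by simp
        then show ?thesis using gh q(2) permutes_inverses(1)[OF p] that by simp
      qed
    qed
  qed
  then show ?thesis
    using card_permutes_fixing_label[OF assms(1-3)] True by (simp add: bij_betw_same_card)
next
  case False
  have "{p. p permutes A \<and> (\<forall>i\<in>A. h (p i) = g i)} = {}"
  proof (rule ccontr)
    assume "\<not> ?thesis"
    then obtain p where p: "p permutes A" "\<forall>i\<in>A. h (p i) = g i" by auto
    have "card {i\<in>A. g i = c} = card {i\<in>A. h i = c}" for c
    proof (rule bij_betw_same_card)
      have "p ` {i\<in>A. g i = c} = {i\<in>A. h i = c}"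
      proof (intro equalityI subsetI)
        fix j assume j: "j \<in> {i\<in>A. h i = c}"
        obtain i where "i \<in> A" "j = p i" using permutes_image[OF p(1)] j by blast
        with j p(2) show "j \<in> p ` {i\<in>A. g i = c}" by auto
      qed (use p permutes_in_image[OF p(1)] in auto)
      then show "bij_betw p {i\<in>A. g i = c} {i\<in>A. h i = c}"
        using inj_on_subset[OF permutes_inj[OF p(1)]] by (auto simp: bij_betw_def)
    qed
    with False show False by blast
  qed
  with False show ?thesis by (simp only: if_False card.empty)
qed

text \<open>A subset of \<open>A\<close> amounts to an independent choice of its intersection with
  each fibre of \<open>g\<close>, and the choices of a given size are counted by a binomial
  coefficient.\<close>

lemma card_subsets_with_label_counts:
  assumes "finite A" "finite C" "g ` A \<subseteq> C"
  shows "card {X. X \<subseteq> A \<and> (\<forall>c\<in>C. card {i\<in>X. g i = c} = s c)} =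
    (\<Prod>c\<in>C. card {i\<in>A. g i = c} choose s c)"
proof -
  let ?F = "\<lambda>c. {i\<in>A. g i = c}"
  let ?P = "\<Pi>\<^sub>E c\<in>C. {Y. Y \<subseteq> ?F c \<and> card Y = s c}"
  let ?Q = "{X. X \<subseteq> A \<and> (\<forall>c\<in>C. card {i\<in>X. g i = c} = s c)}"
  let ?from = "\<lambda>X. restrict (\<lambda>c. {i\<in>X. g i = c}) C"
  have piece: "{i \<in> (\<Union>c\<in>C. Y c). g i = c} = Y c" if "Y \<in> ?P" "c \<in> C" for Y c
    using that by (fastforce simp: PiE_iff)
  have "bij_betw (\<lambda>Y. \<Union>c\<in>C. Y c) ?P ?Q"
  proof (rule bij_betw_byWitness[where f' = ?from])
    show "\<forall>Y\<in>?P. ?from (\<Union>c\<in>C. Y c) = Y"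
    proof
      fix Y assume Y: "Y \<in> ?P"
      show "?from (\<Union>c\<in>C. Y c) = Y"
      proof
        fix c
        show "?from (\<Union>c\<in>C. Y c) c = Y c"
          using piece[OF Y, of c] PiE_arb[OF Y, of c] by (cases "c \<in> C") simp_all
      qed
    qed
    show "\<forall>X\<in>?Q. (\<Union>c\<in>C. ?from X c) = X" using assms(3) by auto
    show "(\<lambda>Y. \<Union>c\<in>C. Y c) ` ?P \<subseteq> ?Q"
    proof (clarify, intro conjI ballI)
      fix Y assume Y: "Y \<in> ?P"
      then show "(\<Union>c\<in>C. Y c) \<subseteq> A" by (fastforce simp: PiE_iff)
      show "card {i \<in> (\<Union>c\<in>C. Y c). g i = c} = s c" if "c \<in> C" for c
        using piece[OF Y that] Y that by (simp add: PiE_iff)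
    qed
    show "?from ` ?Q \<subseteq> ?P" by (auto simp: PiE_iff)
  qed
  then have "card ?Q = card ?P" by (rule bij_betw_same_card[symmetric])
  also have "\<dots> = (\<Prod>c\<in>C. card {Y. Y \<subseteq> ?F c \<and> card Y = s c})" using assms(2) by (rule card_PiE)
  also have "\<dots> = (\<Prod>c\<in>C. card (?F c) choose s c)"
    using assms(1) by (intro prod.cong n_subsets) auto
  finally show ?thesis .
qed

section \<open>Shift-invariant functions and sums over periodic functions\<close>

lemma prod_mod_block:
  fixes f :: "nat \<Rightarrow> 'a :: comm_semiring_1"
  assumes "d dvd n" "0 < d"
  shows "(\<Prod>c<n. f (c mod d)) = (\<Prod>r<d. f r ^ (n div d))"
proof -
  \<comment> \<open>A block of \<open>d\<close> consecutive indices starting at a multiple of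
    \<open>d\<close> meets every residue once; there are \<open>n div d\<close> such blocks.\<close>
  have "(\<Prod>c = m * d..<m * d + d. f (c mod d)) = (\<Prod>r<d. f r)" for m
    by (subst prod.atLeastLessThan_shift_0) (auto simp: atLeast0LessThan intro!: prod.cong)
  then have "(\<Prod>c<(n div d) * d. f (c mod d)) = (\<Prod>r<d. f r) ^ (n div d)"
    unfolding prod.nat_group[symmetric] by simp
  then show ?thesis using assms by (simp add: prod_power_distrib)
qed

text \<open>By Bezout, some multiple of \<open>t\<close> is congruent to the gcd modulo
  \<open>n\<close>, so invariance under steps of \<open>t\<close> gives invariance under steps of
  the gcd.\<close>

lemma shift_invariant_iff_mod_gcd:
  fixes s :: "nat \<Rightarrow> 'b"
  assumes "0 < n"
  shows "(\<forall>c<n. s ((c + t) mod n) = s c) \<longleftrightarrow> (\<forall>c<n. s c = s (c mod gcd n t))"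
proof (intro iffI allI impI)
  assume inv: "\<forall>c<n. s ((c + t) mod n) = s c"
  have iter: "s ((c + m * t) mod n) = s (c mod n)" for c m
  proof (induction m)
    case (Suc m)
    have "s ((c + Suc m * t) mod n) = s (((c + m * t) mod n + t) mod n)"
      by (simp add: mod_simps algebra_simps)
    with Suc inv assms show ?case by simp
  qed simp
  fix c assume c: "c < n"
  let ?d = "gcd n t"
  obtain x where "[t * x = gcd t n] (mod n)" using cong_solve_nat by blast
  \<comment> \<open>Starting at \<open>c mod ?d\<close>, making \<open>c div ?d * x\<close> steps of
    length \<open>t\<close> leads to \<open>c\<close> modulo \<open>n\<close>.\<close>
  then have "[c mod ?d + (c div ?d) * (t * x) = c mod ?d + (c div ?d) * ?d] (mod n)"
    by (intro cong_add cong_mult cong_refl) (simp add: gcd.commute)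
  then have "(c mod ?d + (c div ?d * x) * t) mod n = c"
    using c by (simp add: cong_def algebra_simps)
  moreover have "c mod ?d < n" using c by (meson le_less_trans mod_less_eq_dividend)
  ultimately show "s c = s (c mod ?d)" using iter[of "c mod ?d" "c div ?d * x"] by simp
next
  assume inv: "\<forall>c<n. s c = s (c mod gcd n t)"
  fix c assume c: "c < n"
  \<comment> \<open>The gcd divides both \<open>n\<close> and \<open>t\<close>, so neither the shift
    nor the reduction changes the residue.\<close>
  have "(c + t) mod n mod gcd n t = c mod gcd n t"
    by (metis add.right_neutral gcd_dvd1 gcd_dvd2 dvd_imp_mod_0 mod_add_right_eq mod_mod_cancel)
  moreover have "(c + t) mod n < n" using assms by simp
  ultimately show "s ((c + t) mod n) = s c" using inv c by metis
qed

text \<open>A periodic \<open>s\<close> is determined by its free values on \<open>{..<d}\<close>,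
  each repeated \<open>n div d\<close> times. The remaining sum over all functions on
  \<open>{..<d}\<close> is an expanded product of \<open>d\<close> equal sums.\<close>

lemma sum_periodic_PiE:
  fixes u :: "nat \<Rightarrow> 'a :: comm_semiring_1"
  assumes "d dvd n" "0 < d" "0 < n" "finite B"
  shows "(\<Sum>s | s \<in> (\<Pi>\<^sub>E c\<in>{..<n}. B) \<and> (\<forall>c<n. s c = s (c mod d)). \<Prod>c<n. u (s c)) =
    (\<Sum>l\<in>B. u l ^ (n div d)) ^ d"
proof -
  have dn: "d \<le> n" using assms dvd_imp_le by blast
  let ?S = "{s. s \<in> (\<Pi>\<^sub>E c\<in>{..<n}. B) \<and> (\<forall>c<n. s c = s (c mod d))}"
  have md: "c mod d < d" for c using assms by simp
  have "(\<Sum>s\<in>?S. \<Prod>c<n. u (s c)) = (\<Sum>s\<in>(\<Pi>\<^sub>E r\<in>{..<d}. B). \<Prod>r<d. u (s r) ^ (n div d))"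
  proof (rule sum.reindex_bij_witness[where j = "\<lambda>s. restrict s {..<d}"
        and i = "\<lambda>s. restrict (\<lambda>c. s (c mod d)) {..<n}"])
    fix s assume "s \<in> ?S"
    then have s: "s \<in> (\<Pi>\<^sub>E c\<in>{..<n}. B)" and per: "\<And>c. c < n \<Longrightarrow> s (c mod d) = s c"
      by auto
    show "restrict (\<lambda>c. restrict s {..<d} (c mod d)) {..<n} = s"
    proof
      fix c
      show "restrict (\<lambda>c. restrict s {..<d} (c mod d)) {..<n} c = s c"
        using s per[of c] md[of c] by (cases "c < n") (auto simp: PiE_iff extensional_def)
    qed
    show "restrict s {..<d} \<in> (\<Pi>\<^sub>E r\<in>{..<d}. B)" using s dn by (auto simp: PiE_iff)
    have "(\<Prod>c<n. u (s c)) = (\<Prod>c<n. u (s (c mod d)))" by (intro prod.cong) (simp_all add: per)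
    also have "\<dots> = (\<Prod>r<d. u (s r) ^ (n div d))"
      using assms by (intro prod_mod_block)
    finally show "(\<Prod>r<d. u (restrict s {..<d} r) ^ (n div d)) = (\<Prod>c<n. u (s c))" by simp
  next
    fix s assume s: "s \<in> (\<Pi>\<^sub>E r\<in>{..<d}. B)"
    show "restrict (restrict (\<lambda>c. s (c mod d)) {..<n}) {..<d} = s"
    proof
      fix c
      show "restrict (restrict (\<lambda>c. s (c mod d)) {..<n}) {..<d} c = s c"
        using s dn by (cases "c < d") (auto simp: PiE_iff extensional_def)
    qed
    show "restrict (\<lambda>c. s (c mod d)) {..<n} \<in> ?S"
      using s md dn by (auto simp: PiE_iff intro: less_le_trans)
  qed
  also have "\<dots> = (\<Prod>r<d. \<Sum>l\<in>B. u l ^ (n div d))"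
    using assms by (intro prod_sum_PiE[symmetric]) auto
  finally show ?thesis by simp
qed

section \<open>Entries of the powers of the cyclic shift\<close>

lemma cyclic_shift_mat_power_index:
  assumes "i < n" "j < n"
  shows "(cyclic_shift_mat n ^\<^sub>m t :: 'a :: comm_semiring_1 mat) $$ (i, j) =
    (if j = (i + t) mod n then 1 else 0)"
  using assms
proof (induction t arbitrary: j)
  case 0
  then show ?case by (auto simp: cyclic_shift_mat_def)
next
  case (Suc t)
  let ?P = "cyclic_shift_mat n :: 'a mat"
  have entry: "?P $$ (m, j) = (if j = Suc m mod n then 1 else 0)" if "m < n" for m
  proof -
    have "[int j - int m = 1] (mod int n) \<longleftrightarrow> [int j = int (Suc m)] (mod int n)"
      by (simp add: cong_iff_dvd_diff algebra_simps)
    also have "\<dots> \<longleftrightarrow> j = Suc m mod n"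
      using Suc.prems by (simp only: cong_int_iff) (simp add: cong_def)
    finally show ?thesis using that Suc.prems by (simp add: cyclic_shift_mat_def)
  qed
  have dim: "dim_row ?P = n" "dim_col ?P = n" by (simp_all add: cyclic_shift_mat_def)
  have "(?P ^\<^sub>m Suc t) $$ (i, j) = (\<Sum>m<n. (?P ^\<^sub>m t) $$ (i, m) * ?P $$ (m, j))"
    using Suc.prems by (simp add: dim scalar_prod_def atLeast0LessThan)
  \<comment> \<open>Row \<open>i\<close> of the \<open>t\<close>-th power has a single one; a
    further factor moves it one column on, cyclically.\<close>
  also have "\<dots> = (\<Sum>m<n. if m = (i + t) mod n then (if j = Suc m mod n then 1 else 0) else 0)"
    using Suc.prems by (intro sum.cong) (auto simp: Suc.IH entry)
  also have "\<dots> = (if j = (i + Suc t) mod n then 1 else 0)"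
    using Suc.prems by (simp add: mod_Suc_eq)
  finally show ?case .
qed


section \<open>Indicator products, block labels and the permutations that follow them\<close>

lemma prod_of_bool:
  "finite A \<Longrightarrow> (\<Prod>i\<in>A. of_bool (Q i) :: 'a :: comm_semiring_1) = of_bool (\<forall>i\<in>A. Q i)"
  by (induction A rule: finite_induct) auto

text \<open>The column block prescribed for row \<open>i\<close> when exactly the rows in
  \<open>X\<close> take the entry \<open>a\<^sub>t\<close>.\<close>

definition block_label :: "nat \<Rightarrow> nat \<Rightarrow> nat \<Rightarrow> nat set \<Rightarrow> nat \<Rightarrow> nat" where
  "block_label n k t X i = (if i \<in> X then (i div k + t) mod n else i div k)"

definition block_count :: "nat \<Rightarrow> nat set \<Rightarrow> nat \<Rightarrow> nat" where
  "block_count k X c = card {i\<in>X. i div k = c}"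

lemma card_block:
  assumes "c < n" "0 < k"
  shows "card {i\<in>{0..<n * k}. i div k = c} = k"
proof -
  have "{i\<in>{0..<n * k}. i div k = c} = {c * k..<c * k + k}"
  proof (intro equalityI subsetI)
    fix i assume i: "i \<in> {c * k..<c * k + k}"
    then have "i div k = c" using assms(2) by (intro div_nat_eqI) (auto simp: mult.commute)
    moreover have "c * k + k \<le> n * k"
      using mult_le_mono1[of "Suc c" n k] assms(1) by simp
    ultimately show "i \<in> {i\<in>{0..<n * k}. i div k = c}" using i by auto
  next
    fix i assume "i \<in> {i\<in>{0..<n * k}. i div k = c}"
    then have c: "i div k = c" by simp
    have "i div k * k \<le> i" "i < k + i div k * k"
      using div_times_less_eq_dividend dividend_less_div_times[OF assms(2)] by auto
    then show "i \<in> {c * k..<c * k + k}" unfolding c by (simp only: atLeastLessThan_iff add.commute)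
  qed
  then show ?thesis by simp
qed

text \<open>Two kinds of rows carry the label \<open>(c + t) mod n\<close>: rows of that block
  outside \<open>X\<close>, and rows of block \<open>c\<close> in \<open>X\<close>. No other block
  shifts there, since adding \<open>t\<close> is injective modulo \<open>n\<close>.\<close>

lemma card_block_label_shifted:
  assumes X: "X \<subseteq> {0..<n * k}" and "c < n" "0 < k"
  shows "card {i\<in>{0..<n * k}. block_label n k t X i = (c + t) mod n} =
    k - block_count k X ((c + t) mod n) + block_count k X c"
proof -
  let ?A = "{0..<n * k}"
  define c' where "c' = (c + t) mod n"
  have fin: "finite X" using X finite_subset by blast
  have inj: "(x + t) mod n = c' \<longleftrightarrow> x = c" if "x < n" for x
  proof -
    have "[x + t = c + t] (mod n) \<longleftrightarrow> [x = c] (mod n)" by (rule cong_add_rcancel_nat)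
    then show ?thesis using that assms(2) by (simp add: cong_def c'_def)
  qed
  have label: "block_label n k t X i = c' \<longleftrightarrow> (if i \<in> X then i div k = c else i div k = c')"
    if "i \<in> ?A" for i
    using that by (simp add: block_label_def inj less_mult_imp_div_less)
  \<comment> \<open>The two parts are disjoint because one lies outside \<open>X\<close> and the
    other inside; the blocks themselves coincide when \<open>n\<close> divides
    \<open>t\<close>.\<close>
  have decomp: "{i\<in>?A. block_label n k t X i = c'} =
      ({i\<in>?A. i div k = c'} - {i\<in>X. i div k = c'}) \<union> {i\<in>X. i div k = c}"
  proof (rule Set.set_eqI)
    fix i
    show "i \<in> {i\<in>?A. block_label n k t X i = c'} \<longleftrightarrow>
        i \<in> ({i\<in>?A. i div k = c'} - {i\<in>X. i div k = c'}) \<union> {i\<in>X. i div k = c}"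
    proof (cases "i \<in> ?A")
      case True
      then show ?thesis using label[of i] by simp
    next
      case False
      then show ?thesis using X by blast
    qed
  qed
  have "card {i\<in>?A. block_label n k t X i = c'} =
      card ({i\<in>?A. i div k = c'} - {i\<in>X. i div k = c'}) + block_count k X c"
    unfolding block_count_def decomp by (rule card_Un_disjoint) (use fin in auto)
  also have "card ({i\<in>?A. i div k = c'} - {i\<in>X. i div k = c'}) =
      card {i\<in>?A. i div k = c'} - block_count k X c'"
    unfolding block_count_def by (rule card_Diff_subset) (use fin X in auto)
  also have "card {i\<in>?A. i div k = c'} = k"
    using assms by (intro card_block) (simp_all add: c'_def)
  finally show ?thesis unfolding c'_def .
qed

lemma block_count_le:
  assumes "X \<subseteq> {0..<n * k}" "c < n" "0 < k"
  shows "block_count k X c \<le> k"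
proof -
  have "block_count k X c \<le> card {i\<in>{0..<n * k}. i div k = c}"
    unfolding block_count_def using assms(1) by (intro card_mono) auto
  then show ?thesis using assms by (simp only: card_block)
qed

text \<open>This is \<open>card_permutes_matching_labels\<close> for the block number as
  \<open>h\<close>: its fibres all have size \<open>k\<close>, so the condition on fibre sizes
  becomes shift invariance of the block counts.\<close>

lemma card_permutes_block_label:
  assumes X: "X \<subseteq> {0..<n * k}" and "0 < n" "0 < k"
  shows "card {p. p permutes {0..<n * k} \<and> (\<forall>i\<in>{0..<n * k}. p i div k = block_label n k t X i)} =
    fact k ^ n * of_bool (\<forall>c<n. block_count k X c = block_count k X (c mod gcd n t))"
proof -
  let ?A = "{0..<n * k}"
  let ?g = "block_label n k t X"
  \<comment> \<open>Label sizes are known at shifted indices, and every index is one: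
    \<open>c\<close> is the shift of \<open>c + (n - 1) * t\<close> modulo \<open>n\<close>.\<close>
  have shift: "(\<forall>c<n. P c) \<longleftrightarrow> (\<forall>c<n. P ((c + t) mod n))" for P
  proof (intro iffI allI impI)
    fix c assume P: "\<forall>c<n. P ((c + t) mod n)" and c: "c < n"
    have "((c + (n - 1) * t) mod n + t) mod n = (c + ((n - 1) + 1) * t) mod n"
      by (simp add: mod_simps algebra_simps)
    also have "\<dots> = c" using c by simp
    finally show "P c" using P assms(2) by (metis mod_less_divisor)
  qed (use assms(2) in auto)
  have blk: "card {i\<in>?A. i div k = c} = k" if "c < n" for c
    using that assms(3) by (rule card_block)
  have "(\<forall>c\<in>{..<n}. card {i\<in>?A. ?g i = c} = card {i\<in>?A. i div k = c}) \<longleftrightarrow>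
      (\<forall>c<n. card {i\<in>?A. ?g i = c} = k)"
    using blk by auto
  also have "\<dots> \<longleftrightarrow> (\<forall>c<n. block_count k X ((c + t) mod n) = block_count k X c)"
  proof -
    \<comment> \<open>Block counts are at most \<open>k\<close>, so the truncated subtraction is
      exact and \<open>k\<close> cancels.\<close>
    have "card {i\<in>?A. ?g i = (c + t) mod n} = k \<longleftrightarrow>
        block_count k X ((c + t) mod n) = block_count k X c" if "c < n" for c
      using card_block_label_shifted[OF X that assms(3), of t] block_count_le[OF X that assms(3)]
        block_count_le[OF X mod_less_divisor[OF assms(2)] assms(3), of "c + t"] by auto
    then show ?thesis by (subst shift) blast
  qed
  also have "\<dots> \<longleftrightarrow> (\<forall>c<n. block_count k X c = block_count k X (c mod gcd n t))"
    using assms(2) by (rule shift_invariant_iff_mod_gcd)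
  finally have bal: "(\<forall>c\<in>{..<n}. card {i\<in>?A. ?g i = c} = card {i\<in>?A. i div k = c}) \<longleftrightarrow>
      (\<forall>c<n. block_count k X c = block_count k X (c mod gcd n t))" .
  have "card {p. p permutes ?A \<and> (\<forall>i\<in>?A. p i div k = ?g i)} =
      (if \<forall>c\<in>{..<n}. card {i\<in>?A. ?g i = c} = card {i\<in>?A. i div k = c}
       then \<Prod>c\<in>{..<n}. fact (card {i\<in>?A. i div k = c}) else 0)"
    by (rule card_permutes_matching_labels)
      (use assms in \<open>auto simp: block_label_def less_mult_imp_div_less\<close>)
  also have "(\<Prod>c\<in>{..<n}. fact (card {i\<in>?A. i div k = c})) = (fact k ^ n :: nat)"
    using blk by simp
  finally show ?thesis unfolding bal by simp
qed

section \<open>Expanding the permanent over sets of rows and grouping these by block counts\<close>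

lemma kronecker_all_ones_permanent_expansion:
  fixes a\<^sub>0 a\<^sub>t :: "'a :: comm_ring_1"
  assumes "0 < n" "0 < k"
  shows "permanent ((a\<^sub>0 \<cdot>\<^sub>m 1\<^sub>m n + a\<^sub>t \<cdot>\<^sub>m (cyclic_shift_mat n ^\<^sub>m t)) \<otimes>\<^sub>K all_ones_mat k) =
    (\<Sum>X\<in>Pow {0..<n * k}. a\<^sub>t ^ card X * a\<^sub>0 ^ (n * k - card X) *
      of_nat (card {p. p permutes {0..<n * k} \<and>
        (\<forall>i\<in>{0..<n * k}. p i div k = block_label n k t X i)}))"
proof -
  let ?M = "(a\<^sub>0 \<cdot>\<^sub>m 1\<^sub>m n + a\<^sub>t \<cdot>\<^sub>m (cyclic_shift_mat n ^\<^sub>m t)) \<otimes>\<^sub>K all_ones_mat k"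
  let ?A = "{0..<n * k}"
  let ?S = "{p. p permutes ?A}"
  let ?ft = "\<lambda>p i. a\<^sub>t * of_bool (p i div k = (i div k + t) mod n)"
  let ?f0 = "\<lambda>p i. a\<^sub>0 * of_bool (p i div k = i div k)"
  have dim: "dim_row (cyclic_shift_mat n :: 'a mat) = n" "dim_col (cyclic_shift_mat n :: 'a mat) = n"
    by (simp_all add: cyclic_shift_mat_def)
  \<comment> \<open>Two separate indicators also cover the case that \<open>n\<close> divides
    \<open>t\<close>, where both hold on the same block and the entry is
    \<open>a\<^sub>0 + a\<^sub>t\<close>.\<close>
  have entry: "?M $$ (i, p i) = ?ft p i + ?f0 p i" if "p \<in> ?S" "i \<in> ?A" for p i
  proof -
    have "p i < n * k" using permutes_in_image[of p ?A i] that by simp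
    then have j: "p i < n * k" "p i div k < n" by (auto simp: less_mult_imp_div_less)
    have i: "i < n * k" "i div k < n" using that by (auto simp: less_mult_imp_div_less)
    have "?M $$ (i, p i) =
        (a\<^sub>0 \<cdot>\<^sub>m 1\<^sub>m n + a\<^sub>t \<cdot>\<^sub>m (cyclic_shift_mat n ^\<^sub>m t)) $$ (i div k, p i div k)"
      using i(1) j(1) assms(2) by (simp add: kronecker_product_def all_ones_mat_def dim)
    also have "\<dots> = a\<^sub>0 * of_bool (i div k = p i div k) +
        a\<^sub>t * (cyclic_shift_mat n ^\<^sub>m t) $$ (i div k, p i div k)"
      using i(2) j(2) by (simp add: dim)
    also have "\<dots> = ?ft p i + ?f0 p i"
      unfolding cyclic_shift_mat_power_index[OF i(2) j(2)] by auto
    finally show ?thesis .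
  qed
  have term_X: "(\<Prod>i\<in>X. ?ft p i) * (\<Prod>i\<in>?A - X. ?f0 p i) =
      a\<^sub>t ^ card X * a\<^sub>0 ^ (n * k - card X) * of_bool (\<forall>i\<in>?A. p i div k = block_label n k t X i)"
    if "X \<in> Pow ?A" for p X
  proof -
    have X: "X \<subseteq> ?A" "finite X" using that finite_subset by auto
    have "(\<forall>i\<in>?A. p i div k = block_label n k t X i) \<longleftrightarrow>
        (\<forall>i\<in>X. p i div k = (i div k + t) mod n) \<and> (\<forall>i\<in>?A - X. p i div k = i div k)"
      using X by (auto simp: block_label_def)
    moreover have "card (?A - X) = n * k - card X" using X by (simp add: card_Diff_subset)
    ultimately show ?thesis
      using X(2) by (simp add: prod.distrib prod_of_bool of_bool_conj mult_ac)
  qed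
  have finS: "finite ?S" by (simp add: finite_permutations)
  have "permanent ?M = (\<Sum>p\<in>?S. \<Prod>i\<in>?A. ?M $$ (i, p i))"
    by (simp add: permanent_def kronecker_product_def all_ones_mat_def dim)
  also have "\<dots> = (\<Sum>p\<in>?S. \<Prod>i\<in>?A. ?ft p i + ?f0 p i)"
    by (intro sum.cong prod.cong refl entry)
  also have "\<dots> = (\<Sum>p\<in>?S. \<Sum>X\<in>Pow ?A. (\<Prod>i\<in>X. ?ft p i) * (\<Prod>i\<in>?A - X. ?f0 p i))"
    by (intro sum.cong refl prod_add) simp
  also have "\<dots> = (\<Sum>p\<in>?S. \<Sum>X\<in>Pow ?A. a\<^sub>t ^ card X * a\<^sub>0 ^ (n * k - card X) *
      of_bool (\<forall>i\<in>?A. p i div k = block_label n k t X i))"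
    by (intro sum.cong refl term_X)
  \<comment> \<open>The weight depends on \<open>X\<close> alone, so after exchanging the sums the
    inner one counts permutations.\<close>
  also have "\<dots> = (\<Sum>X\<in>Pow ?A. a\<^sub>t ^ card X * a\<^sub>0 ^ (n * k - card X) *
      (\<Sum>p\<in>?S. of_bool (\<forall>i\<in>?A. p i div k = block_label n k t X i)))"
    unfolding sum_distrib_left by (rule sum.swap)
  also have "\<dots> = (\<Sum>X\<in>Pow ?A. a\<^sub>t ^ card X * a\<^sub>0 ^ (n * k - card X) *
      of_nat (card {p. p permutes ?A \<and> (\<forall>i\<in>?A. p i div k = block_label n k t X i)}))"
    using finS by (simp only: sum_of_bool_eq Collect_conj_eq)
  finally show ?thesis .
qed

text \<open>The subsets are grouped by their vector of block counts; each block of size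
  \<open>k\<close> offers \<open>k choose s c\<close> choices. Restricting the vector to
  \<open>{..<n}\<close> places it in a finite function space.\<close>

lemma sum_subsets_by_block_count:
  fixes G :: "(nat \<Rightarrow> nat) \<Rightarrow> 'a :: comm_semiring_1"
  assumes "0 < k"
  shows "(\<Sum>X\<in>Pow {0..<n * k}. G (restrict (block_count k X) {..<n})) =
    (\<Sum>s\<in>(\<Pi>\<^sub>E c\<in>{..<n}. {0..k}). (\<Prod>c<n. of_nat (k choose s c)) * G s)"
proof -
  let ?A = "{0..<n * k}"
  let ?s = "\<lambda>X. restrict (block_count k X) {..<n}"
  let ?T = "\<Pi>\<^sub>E c\<in>{..<n}. {0..k}"
  have "(\<Sum>X\<in>Pow ?A. G (?s X)) = (\<Sum>s\<in>?T. \<Sum>X\<in>{X. X \<in> Pow ?A \<and> ?s X = s}. G (?s X))"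
  proof (rule sum.group[symmetric])
    show "?s ` Pow ?A \<subseteq> ?T"
      using assms by (intro image_subsetI) (simp add: restrict_PiE_iff block_count_le)
  qed (auto intro: finite_PiE)
  also have "\<dots> = (\<Sum>s\<in>?T. (\<Prod>c<n. of_nat (k choose s c)) * G s)"
  proof (rule sum.cong[OF refl])
    fix s assume s: "s \<in> ?T"
    have fibre: "{X. X \<in> Pow ?A \<and> ?s X = s} =
        {X. X \<subseteq> ?A \<and> (\<forall>c\<in>{..<n}. card {i\<in>X. i div k = c} = s c)}"
      using s by (auto simp: block_count_def PiE_iff extensional_def fun_eq_iff)
    have "card {X. X \<in> Pow ?A \<and> ?s X = s} = (\<Prod>c\<in>{..<n}. card {i\<in>?A. i div k = c} choose s c)"
      unfolding fibre by (rule card_subsets_with_label_counts) (auto simp: less_mult_imp_div_less)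
    also have "\<dots> = (\<Prod>c<n. k choose s c)"
      using card_block[OF _ assms] by (intro prod.cong refl) simp
    finally have "card {X. X \<in> Pow ?A \<and> ?s X = s} = (\<Prod>c<n. k choose s c)" .
    then show "(\<Sum>X\<in>{X. X \<in> Pow ?A \<and> ?s X = s}. G (?s X)) =
        (\<Prod>c<n. of_nat (k choose s c)) * G s"
      by simp
  qed
  finally show ?thesis .
qed

lemma sum_block_count:
  assumes "X \<subseteq> {0..<n * k}"
  shows "(\<Sum>c<n. block_count k X c) = card X"
proof -
  have "finite X" using assms finite_subset by blast
  moreover have "(\<lambda>i. i div k) ` X \<subseteq> {..<n}"
    using assms by (auto simp: less_mult_imp_div_less)
  ultimately show ?thesis
    using sum.group[of X "{..<n}" "\<lambda>i. i div k" "\<lambda>_. 1 :: nat"]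
    by (simp add: block_count_def)
qed

section \<open>Factoring the weights over blocks and summing over periodic counts\<close>

theorem theorem32:
  fixes a\<^sub>0 a\<^sub>t :: "'a :: comm_ring_1" and n t k d :: nat
  assumes "n \<ge> 1" and "t \<ge> 1" and "k \<ge> 1" and "d = gcd n t"
  shows "permanent ((a\<^sub>0 \<cdot>\<^sub>m 1\<^sub>m n + a\<^sub>t \<cdot>\<^sub>m (cyclic_shift_mat n ^\<^sub>m t)) \<otimes>\<^sub>K all_ones_mat k)
    = (of_nat (fact k) ^ (n div d) *
        (\<Sum>l = 0..k. of_nat (k choose l) ^ (n div d) * (a\<^sub>0 ^ (k - l) * a\<^sub>t ^ l) ^ (n div d))) ^ d"
proof -
  let ?A = "{0..<n * k}"
  let ?M = "(a\<^sub>0 \<cdot>\<^sub>m 1\<^sub>m n + a\<^sub>t \<cdot>\<^sub>m (cyclic_shift_mat n ^\<^sub>m t)) \<otimes>\<^sub>K all_ones_mat k"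
  let ?T = "\<Pi>\<^sub>E c\<in>{..<n}. {0..k}"
  let ?w = "\<lambda>l. a\<^sub>0 ^ (k - l) * a\<^sub>t ^ l"
  let ?u = "\<lambda>l. of_nat (k choose l) * ?w l"
  let ?per = "\<lambda>s :: nat \<Rightarrow> nat. \<forall>c<n. s c = s (c mod d)"
  let ?G = "\<lambda>s. (\<Prod>c<n. ?w (s c)) * of_bool (?per s)"
  have pos: "0 < n" "0 < k" and d: "d dvd n" "0 < d" using assms by simp_all
  \<comment> \<open>The exponents \<open>card X\<close> and \<open>n * k - card X\<close> are the
    sums over the blocks of the counts and of their complements in \<open>k\<close>.\<close>
  have weight: "a\<^sub>t ^ card X * a\<^sub>0 ^ (n * k - card X) = (\<Prod>c<n. ?w (block_count k X c))"
    if X: "X \<subseteq> ?A" for X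
  proof -
    have "(\<Sum>c<n. k - block_count k X c) = n * k - card X"
      using block_count_le[OF X _ pos(2)] sum_block_count[OF X]
      by (subst sum_subtractf_nat) simp_all
    then show ?thesis
      using sum_block_count[OF X] by (simp add: prod.distrib mult.commute flip: power_sum)
  qed
  have "permanent ?M = (\<Sum>X\<in>Pow ?A. a\<^sub>t ^ card X * a\<^sub>0 ^ (n * k - card X) *
      of_nat (card {p. p permutes ?A \<and> (\<forall>i\<in>?A. p i div k = block_label n k t X i)}))"
    using pos by (rule kronecker_all_ones_permanent_expansion)
  also have "\<dots> = (\<Sum>X\<in>Pow ?A. of_nat (fact k) ^ n * ?G (restrict (block_count k X) {..<n}))"
  proof (rule sum.cong[OF refl])
    fix X assume "X \<in> Pow ?A"
    then have X: "X \<subseteq> ?A" by simp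
    \<comment> \<open>For \<open>c < n\<close> also \<open>c mod d < n\<close>, so the restriction
      never yields its default value here.\<close>
    have per: "?per (restrict (block_count k X) {..<n}) \<longleftrightarrow> ?per (block_count k X)"
      by (auto intro: le_less_trans[OF mod_less_eq_dividend])
    show "a\<^sub>t ^ card X * a\<^sub>0 ^ (n * k - card X) *
        of_nat (card {p. p permutes ?A \<and> (\<forall>i\<in>?A. p i div k = block_label n k t X i)}) =
        of_nat (fact k) ^ n * ?G (restrict (block_count k X) {..<n})"
      unfolding weight[OF X] card_permutes_block_label[OF X pos] per by (simp add: assms(4))
  qed
  also have "\<dots> = of_nat (fact k) ^ n * (\<Sum>s\<in>?T. (\<Prod>c<n. of_nat (k choose s c)) * ?G s)"
    unfolding sum_distrib_left[symmetric] using pos(2)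
    by (subst sum_subsets_by_block_count) simp_all
  also have "(\<Sum>s\<in>?T. (\<Prod>c<n. of_nat (k choose s c)) * ?G s) =
      (\<Sum>s\<in>?T. if ?per s then \<Prod>c<n. ?u (s c) else 0)"
  proof -
    have "x * (y * of_bool P) = (if P then x * y else 0)" for x y :: 'a and P by simp
    then show ?thesis by (simp only: prod.distrib)
  qed
  also have "\<dots> = (\<Sum>s | s \<in> ?T \<and> ?per s. \<Prod>c<n. ?u (s c))"
    by (rule sum.inter_filter[symmetric]) (auto intro: finite_PiE)
  also have "\<dots> = (\<Sum>l=0..k. ?u l ^ (n div d)) ^ d"
    using d pos(1) by (intro sum_periodic_PiE) auto
  \<comment> \<open>Since \<open>d\<close> divides \<open>n\<close>, the factorial factor is itself
    a \<open>d\<close>-th power and moves inside the bracket.\<close>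
  also have "of_nat (fact k) ^ n = ((of_nat (fact k) ^ (n div d)) ^ d :: 'a)"
    using d by (simp flip: power_mult)
  finally show ?thesis by (simp only: power_mult_distrib)
qed

end
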